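(* Let $c=0$ and let $z_0\in\mathbb{C}$ satisfy $|z_0|=1$ and $z_0\neq 1$. Then the Exponent Set $E(z_0,0)$ admits no finite universal escape radius. More precisely, for every real $r>0$ there exists an exponent $x\in E(z_0,0)$ such that the orbit generated by $z_{n+1}=z_n^{\,x}$ from $z_0$ satisfies $|z_n|>r$ for some $n\ge 0$, while the orbit remains bounded.
   Context: Complex powers: for $z\in\mathbb{C}\setminus\{0\}$ let $\log z=\ln|z|+i\operatorname{Arg}(z)$ with $\operatorname{Arg}(z)\in(-\pi,\pi]$ (so $\operatorname{Arg}(-a)=\pi$ for $a>0$), and for $x\in\mathbb{C}$ set $z^x=\exp(x\log z)$. For $z=0$: $0^x=0$ if $\operatorname{Re}(x)>0$, and $0^x$ is undefined if $\operatorname{Re}(x)\le 0$. For $(z_0,c,x)\in\mathbb{C}^3$, the orbit $\{z_n\}$ is generated by $z_{n+1}=z_n^{\,x}+c$, continuing as long as the next iterate is defined and terminating otherwise. Exponent Set: for fixed $z_0,c\in\mathbb{C}$, $E(z_0,c)$ is the set of all $x\in\mathbb{C}$ such that $z_n$ is defined for every $n\ge 0$ and $\sup_{n\ge0}|z_n|<\infty$. Universal escape radius: for fixed $z_0,c\in\mathbb{C}$, a finite number $r>0$ is called a universal escape radius for $E(z_0,c)$ if, for every $x\in\mathbb{C}$ for which the orbit is well-defined for all $n\ge 0$, the existence of some $n\ge0$ with $|z_n|>r$ implies $x\notin E(z_0,c)$. *)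

theory Defs
  imports "HOL-Analysis.Complex_Transcendental"
begin

text \<open>Complex power with principal logarithm: on complex arguments the library's
  \<open>powr\<close> is \<open>exp (x * Ln z)\<close> with \<open>Im (Ln z)\<close> in the interval from \<open>-pi\<close> (excluded) to \<open>pi\<close>
  (included) for nonzero \<open>z\<close>. The library totalises \<open>0 powr x = 0\<close>; here \<open>0\<close> to the power \<open>x\<close>
  is undefined (\<open>None\<close>) unless \<open>Re x > 0\<close>.\<close>

definition cpow :: "complex \<Rightarrow> complex \<Rightarrow> complex option" where
  "cpow z x = (if z = 0 then (if Re x > 0 then Some 0 else None) else Some (z powr x))"

text \<open>The orbit is \<open>None\<close> from the first undefined iterate onwards.\<close>

primrec orbit :: "complex \<Rightarrow> complex \<Rightarrow> complex \<Rightarrow> nat \<Rightarrow> complex option" where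
  "orbit z0 c x 0 = Some z0"
| "orbit z0 c x (Suc n) =
     (case orbit z0 c x n of None \<Rightarrow> None | Some z \<Rightarrow> map_option (\<lambda>w. w + c) (cpow z x))"

definition orbit_defined :: "complex \<Rightarrow> complex \<Rightarrow> complex \<Rightarrow> bool" where
  "orbit_defined z0 c x \<longleftrightarrow> (\<forall>n. orbit z0 c x n \<noteq> None)"

text \<open>Only meaningful as long as the orbit has not terminated.\<close>

definition iterate :: "complex \<Rightarrow> complex \<Rightarrow> complex \<Rightarrow> nat \<Rightarrow> complex" where
  "iterate z0 c x n = the (orbit z0 c x n)"

definition exponent_set :: "complex \<Rightarrow> complex \<Rightarrow> complex set" where
  "exponent_set z0 c =
     {x. orbit_defined z0 c x \<and> bdd_above (range (\<lambda>n. cmod (iterate z0 c x n)))}"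

definition universal_escape_radius :: "complex \<Rightarrow> complex \<Rightarrow> real \<Rightarrow> bool" where
  "universal_escape_radius z0 c r \<longleftrightarrow>
     r > 0 \<and>
     (\<forall>x. orbit_defined z0 c x \<longrightarrow> (\<exists>n. cmod (iterate z0 c x n) > r) \<longrightarrow> x \<notin> exponent_set z0 c)"

end

theory Submission
  imports Defs
begin

text \<open>
  Write \<open>z0 = exp (\<i> \<theta>)\<close> with \<open>\<theta> = Im (Ln z0) \<noteq> 0\<close>. There are exponents that send \<open>z0\<close> as far
  out along the positive real axis as desired and return it to the fixed point \<open>1\<close> one step later.
  For real \<open>a\<close> the exponent \<open>x = - \<i> a / \<theta>\<close> satisfies \<open>x * (\<i> \<theta>) = a\<close>, so \<open>z\<^sub>1 = exp a\<close>. As \<open>a\<close>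
  is real, the principal logarithm of \<open>z\<^sub>1\<close> is exactly \<open>a\<close>, without a branch correction, and hence
  \<open>z\<^sub>2 = exp (- \<i> a\<^sup>2 / \<theta>)\<close>. This equals \<open>1\<close> as soon as \<open>a\<^sup>2\<close> is a multiple of \<open>2 \<pi> \<bar>\<theta>\<bar>\<close>. Since there
  are arbitrarily large such \<open>a\<close>, the orbit \<open>z0, exp a, 1, 1, \<dots>\<close> can be made to leave any disc
  although it takes only three values.
\<close>

lemma orbit_Suc_zero_offset:
  assumes "orbit z0 0 x n = Some z" and "z \<noteq> 0"
  shows "orbit z0 0 x (Suc n) = Some (z powr x)"
  using assms by (simp add: cpow_def)

lemma orbit_stays_at_one:
  assumes "orbit z0 0 x k = Some 1"
  shows "orbit z0 0 x (k + n) = Some 1"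
  by (induction n) (use assms in \<open>auto simp: cpow_def\<close>)

text \<open>Such an orbit takes finitely many values.\<close>

lemma
  assumes "orbit z0 0 x k = Some 1"
  shows in_exponent_set_if_reaches_one: "x \<in> exponent_set z0 0"
    and bounded_orbit_if_reaches_one: "bounded (range (iterate z0 0 x))"
proof -
  have one: "orbit z0 0 x n = Some 1" if "n \<ge> k" for n
    using orbit_stays_at_one[OF assms, of "n - k"] that by simp
  have "orbit z0 0 x n \<noteq> None" for n
  proof (cases "n \<ge> k")
    case False
    \<comment> \<open>Termination is permanent, so an orbit that is defined at time \<open>k\<close> was defined before.\<close>
    have "orbit z0 0 x (n + j) = None" if "orbit z0 0 x n = None" for j
      using that by (induction j) auto
    from this[of "k - n"] show ?thesis using assms False by auto
  qed (simp add: one)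
  then have "orbit_defined z0 0 x"
    by (simp add: orbit_defined_def)
  moreover have "range (iterate z0 0 x) \<subseteq> insert 1 (iterate z0 0 x ` {..<k})"
    using one by (force simp: iterate_def not_le[symmetric])
  then have fin: "finite (range (iterate z0 0 x))"
    by (rule finite_subset) simp
  moreover have "finite (range (\<lambda>n. cmod (iterate z0 0 x n)))"
    using finite_imageI[OF fin, of cmod] by (simp add: image_image)
  ultimately show "x \<in> exponent_set z0 0" "bounded (range (iterate z0 0 x))"
    by (auto simp: exponent_set_def intro: finite_imp_bounded)
qed

text \<open>
  The sign of \<open>\<theta>\<close> may be absorbed into the multiple of \<open>2 \<pi>\<close>, which is why \<open>\<bar>\<theta>\<bar>\<close> suffices here.
\<close>

lemma exp_neg_i_square_over_angle:
  fixes a \<theta> :: real and m :: nat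
  assumes "a\<^sup>2 = real m * (2 * pi * \<bar>\<theta>\<bar>)" and "\<theta> \<noteq> 0"
  shows "exp (- \<i> * complex_of_real (a\<^sup>2 / \<theta>)) = 1"
proof -
  have "a\<^sup>2 / \<theta> = 2 * of_int (int m * (if \<theta> > 0 then 1 else - 1)) * pi"
    using assms by (simp add: field_simps)
  then show ?thesis
    unfolding exp_eq_1 by (intro conjI exI[of _ "- (int m * (if \<theta> > 0 then 1 else - 1))"]) auto
qed

lemma far_excursion_then_one:
  fixes z0 :: complex and r :: real
  assumes "cmod z0 = 1" and "z0 \<noteq> 1"
  obtains x a where "a > r" "orbit z0 0 x 1 = Some (complex_of_real (exp a))"
    "orbit z0 0 x 2 = Some 1"
proof -
  define \<theta> where "\<theta> = Im (Ln z0)"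
  have nz: "z0 \<noteq> 0" using assms by auto
  have Ln_z0: "Ln z0 = \<i> * \<theta>"
    using nz assms(1) by (simp add: complex_eq_iff \<theta>_def)
  have \<theta>: "\<theta> \<noteq> 0"
    using exp_Ln[OF nz] Ln_z0 assms(2) by auto
  obtain m :: nat where m: "r\<^sup>2 < real m * (2 * pi * \<bar>\<theta>\<bar>)"
    using reals_Archimedean3[of "2 * pi * \<bar>\<theta>\<bar>"] \<theta> by auto
  define a where "a = sqrt (real m * (2 * pi * \<bar>\<theta>\<bar>))"
  have a2: "a\<^sup>2 = real m * (2 * pi * \<bar>\<theta>\<bar>)"
    by (simp add: a_def)
  have "a > r"
    unfolding a_def using m by (rule real_less_rsqrt)
  define x where "x = - \<i> * complex_of_real (a / \<theta>)"
  have "x * Ln z0 = complex_of_real a"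
    using \<theta> by (simp add: Ln_z0 x_def complex_eq_iff)
  then have "z0 powr x = exp (complex_of_real a)"
    using nz by (simp add: powr_def)
  then have z1: "orbit z0 0 x 1 = Some (complex_of_real (exp a))"
    using orbit_Suc_zero_offset[of z0 x 0 z0] nz by (simp add: exp_of_real)
  have "x * complex_of_real a = - \<i> * complex_of_real (a\<^sup>2 / \<theta>)"
    by (simp add: x_def power2_eq_square)
  then have "complex_of_real (exp a) powr x = 1"
    using exp_neg_i_square_over_angle[OF a2 \<theta>] by (simp add: powr_def Ln_of_real)
  then have "orbit z0 0 x 2 = Some 1"
    using orbit_Suc_zero_offset[OF z1] by (simp add: numeral_2_eq_2)
  with \<open>a > r\<close> z1 show thesis by (rule that)
qed

theorem theorem3p1:
  fixes z0 :: complex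
  assumes "cmod z0 = 1" and "z0 \<noteq> 1"
  shows "(\<nexists>r. universal_escape_radius z0 0 r) \<and>
         (\<forall>r>0. \<exists>x\<in>exponent_set z0 0.
            (\<exists>n. cmod (iterate z0 0 x n) > r) \<and>
            bounded (range (iterate z0 0 x)))"
proof -
  have excursion: "\<exists>x\<in>exponent_set z0 0.
      (\<exists>n. cmod (iterate z0 0 x n) > r) \<and> bounded (range (iterate z0 0 x))" for r :: real
  proof -
    obtain x a where xa: "a > r" "orbit z0 0 x 1 = Some (complex_of_real (exp a))"
      "orbit z0 0 x 2 = Some 1"
      using far_excursion_then_one[OF assms] by blast
    have "cmod (iterate z0 0 x 1) = exp a"
      unfolding iterate_def xa(2) by simp
    moreover have "exp a > r"
      using xa(1) exp_ge_add_one_self[of a] by linarith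
    ultimately have "\<exists>n. cmod (iterate z0 0 x n) > r"
      by metis
    then show ?thesis
      using in_exponent_set_if_reaches_one[OF xa(3)] bounded_orbit_if_reaches_one[OF xa(3)]
      by blast
  qed
  then show ?thesis
    by (fastforce simp: universal_escape_radius_def exponent_set_def)
qed

end
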